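(* For any partial sign matrix $A\in\{-1,1,*\}^{M\times N}$, $$\operatorname{ind}_{\mathbb{Z}_2}(S(A))\le 2h(A)-1 .$$
   Context: Height. For $A\in\{-1,1,*\}^{M\times N}$ and each row $i\in[M]$ let $R_i^+=\{j\in[N]:A_{ij}=+1\}$ and $R_i^-=\{j\in[N]:A_{ij}=-1\}$. Let $\mathcal{R}(A)=\{R_i^+,R_i^-: i\in[M]\}$, and let $\mathcal{I}(A)$ be the family of all nonempty sets of the form $\bigcap_{t=1}^k F_t$ with $k\ge 1$ and $F_t\in\mathcal{R}(A)$. The height $h(A)$ is the maximum $k$ for which there is a strict chain $S_1\subsetneq S_2\subsetneq\cdots\subsetneq S_k$ with all $S_i\in\mathcal{I}(A)$. Sign complex. For each row $r$ of $A$, let $\sigma_r^+=\{i^+: r_i=+1\}\cup\{i^-: r_i=-1\}$ and $\sigma_r^-=\{i^-: r_i=+1\}\cup\{i^+: r_i=-1\}$. The sign complex $S(A)$ is the abstract simplicial complex on vertex set $\{1^+,1^-,\dots,N^+,N^-\}$ whose simplices are all subsets of $\sigma_r^+$ or $\sigma_r^-$ for some row $r$ of $A$. The involution $i^+\leftrightarrow i^-$ is a free simplicial $\mathbb{Z}_2$-action on $S(A)$, inducing a free action on the geometric realization $|S(A)|$. Index. For a free $\mathbb{Z}_2$-complex $K$ (a simplicial complex with a free simplicial $\mathbb{Z}_2$-action), $\operatorname{ind}_{\mathbb{Z}_2}(K)$ is the minimum $d\ge 0$ for which there is a continuous $\mathbb{Z}_2$-equivariant map $|K|\to\mathbb{S}^d$,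 where $\mathbb{S}^d$ carries the antipodal action. *)

theory Defs
  imports "HOL-Analysis.Analysis" "HOL-Library.Extended_Nat"
begin

section \<open>Partial sign matrices and their height\<close>

datatype psign = Pos | Neg | Star

text \<open>An \<open>M \<times> N\<close> partial sign matrix is a term \<open>A :: psign^'n^'m\<close> with \<open>CARD('m) = M\<close> and
  \<open>CARD('n) = N\<close>; \<open>A $ i $ j\<close> is the entry in row \<open>i\<close> and column \<open>j\<close>.\<close>

definition row_pos :: "psign^'n^'m \<Rightarrow> 'm \<Rightarrow> 'n set"
  where "row_pos A i = {j. A $ i $ j = Pos}"

definition row_neg :: "psign^'n^'m \<Rightarrow> 'm \<Rightarrow> 'n set"
  where "row_neg A i = {j. A $ i $ j = Neg}"

definition row_sets :: "psign^'n^'m \<Rightarrow> 'n set set"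
  where "row_sets A = range (row_pos A) \<union> range (row_neg A)"

definition intersection_family :: "psign^'n^'m \<Rightarrow> 'n set set"
  where "intersection_family A =
    {S. S \<noteq> {} \<and> (\<exists>\<F>. finite \<F> \<and> \<F> \<noteq> {} \<and> \<F> \<subseteq> row_sets A \<and> S = \<Inter>\<F>)}"

text \<open>A chain is a list \<open>[S\<^sub>1, \<dots>, S\<^sub>k]\<close> with \<open>S\<^sub>1 \<subset> \<dots> \<subset> S\<^sub>k\<close>. The empty chain is allowed, which
  only matters if \<open>intersection_family A\<close> is empty, i.e. if all entries of \<open>A\<close> are \<open>Star\<close>;
  the height is then \<open>0\<close>.\<close>

definition height :: "psign^'n^'m \<Rightarrow> nat"
  where "height A =
    Max {length Ss | Ss. set Ss \<subseteq> intersection_family A \<and> sorted_wrt (\<subset>) Ss}"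


section \<open>Free involutions on finite simplicial complexes and the index\<close>

text \<open>Complexes may contain the empty simplex; it does not contribute to the realization.\<close>

definition abstract_simplicial_complex :: "'v set set \<Rightarrow> bool"
  where "abstract_simplicial_complex K \<longleftrightarrow> (\<forall>s\<in>K. finite s \<and> (\<forall>t\<subseteq>s. t \<in> K))"

text \<open>Points are given by their barycentric coordinates. As the vertex type is finite, the
  subspace topology of the product topology is the usual (coherent) topology.\<close>

definition realization :: "('v::finite) set set \<Rightarrow> ('v \<Rightarrow> real) topology"
  where "realization K = subtopology (powertop_real UNIV)
    {x. (\<forall>v. 0 \<le> x v) \<and> (\<Sum>v\<in>UNIV. x v) = 1 \<and> {v. x v \<noteq> 0} \<in> K}"

text \<open>The map on the realization induced by a vertex involution \<open>\<nu>\<close> is \<open>x \<mapsto> x \<circ> \<nu>\<close>, because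
  \<open>\<nu>\<close> is its own inverse.\<close>

definition free_Z2_complex :: "('v::finite) set set \<Rightarrow> ('v \<Rightarrow> 'v) \<Rightarrow> bool"
  where "free_Z2_complex K \<nu> \<longleftrightarrow>
    abstract_simplicial_complex K \<and> (\<forall>v. \<nu> (\<nu> v) = v) \<and> (\<forall>s\<in>K. \<nu> ` s \<in> K) \<and>
    (\<forall>x\<in>topspace (realization K). x \<circ> \<nu> \<noteq> x)"

text \<open>\<open>nsphere d\<close> is the unit sphere of dimension \<open>d\<close>. The infimum is a minimum whenever some
  equivariant map exists, and \<open>\<infinity>\<close> otherwise.\<close>

definition Z2_index :: "('v::finite) set set \<Rightarrow> ('v \<Rightarrow> 'v) \<Rightarrow> enat"
  where "Z2_index K \<nu> = Inf {enat d | d. \<exists>f.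
    continuous_map (realization K) (nsphere d) f \<and>
    (\<forall>x\<in>topspace (realization K). f (x \<circ> \<nu>) = (\<lambda>i. - f x i))}"


section \<open>The sign complex\<close>

text \<open>The vertices \<open>i\<^sup>+\<close> and \<open>i\<^sup>-\<close> are encoded as \<open>(i, True)\<close> and \<open>(i, False)\<close>.\<close>

definition sigma_pos :: "psign^'n^'m \<Rightarrow> 'm \<Rightarrow> ('n \<times> bool) set"
  where "sigma_pos A r = {(i, True) | i. A $ r $ i = Pos} \<union> {(i, False) | i. A $ r $ i = Neg}"

definition sigma_neg :: "psign^'n^'m \<Rightarrow> 'm \<Rightarrow> ('n \<times> bool) set"
  where "sigma_neg A r = {(i, False) | i. A $ r $ i = Pos} \<union> {(i, True) | i. A $ r $ i = Neg}"

definition sign_complex :: "psign^'n^'m \<Rightarrow> ('n \<times> bool) set set"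
  where "sign_complex A = {s. \<exists>r. s \<subseteq> sigma_pos A r \<or> s \<subseteq> sigma_neg A r}"

definition flip_sign :: "'n \<times> bool \<Rightarrow> 'n \<times> bool"
  where "flip_sign v = (fst v, \<not> snd v)"


section \<open>Sanity checks\<close>

lemma free_Z2_complex_sign_complex: "free_Z2_complex (sign_complex A) flip_sign"
proof -
  have inv: "flip_sign (flip_sign v) = v" for v :: "'a \<times> bool"
    by (simp add: flip_sign_def)
  have asc: "abstract_simplicial_complex (sign_complex A)"
    unfolding abstract_simplicial_complex_def sign_complex_def by fastforce
  have flip: "flip_sign ` sigma_pos A r \<subseteq> sigma_neg A r"
    "flip_sign ` sigma_neg A r \<subseteq> sigma_pos A r" for r
    by (auto simp: flip_sign_def sigma_pos_def sigma_neg_def)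
  have simp: "flip_sign ` s \<in> sign_complex A" if "s \<in> sign_complex A" for s
  proof -
    from that obtain r where "s \<subseteq> sigma_pos A r \<or> s \<subseteq> sigma_neg A r"
      unfolding sign_complex_def by blast
    then have "flip_sign ` s \<subseteq> sigma_pos A r \<or> flip_sign ` s \<subseteq> sigma_neg A r"
      using flip[of r] by blast
    then show ?thesis unfolding sign_complex_def by blast
  qed
  have free: "x \<circ> flip_sign \<noteq> x" if x: "x \<in> topspace (realization (sign_complex A))" for x
  proof
    assume eq: "x \<circ> flip_sign = x"
    have supp: "{v. x v \<noteq> 0} \<in> sign_complex A" and sum: "(\<Sum>v\<in>UNIV. x v) = 1"
      using x by (auto simp: realization_def)
    obtain v where v: "x v \<noteq> 0"
      using sum by (metis sum.neutral zero_neq_one)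
    obtain i b where ib: "v = (i, b)" by fastforce
    have "x (i, b) \<noteq> 0" using v ib by simp
    moreover have "x (i, \<not> b) = x (i, b)"
      using fun_cong[OF eq, of "(i, b)"] by (simp add: flip_sign_def)
    ultimately have "x (i, c) \<noteq> 0" for c
      by (cases "c = b") auto
    then have "(i, c) \<in> {v. x v \<noteq> 0}" for c by simp
    moreover obtain r where "{v. x v \<noteq> 0} \<subseteq> sigma_pos A r \<or> {v. x v \<noteq> 0} \<subseteq> sigma_neg A r"
      using supp unfolding sign_complex_def by blast
    ultimately have "(\<forall>c. (i, c) \<in> sigma_pos A r) \<or> (\<forall>c. (i, c) \<in> sigma_neg A r)"
      by blast
    then have "((i, True) \<in> sigma_pos A r \<and> (i, False) \<in> sigma_pos A r) \<or>
        ((i, True) \<in> sigma_neg A r \<and> (i, False) \<in> sigma_neg A r)" by blast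
    then show False by (auto simp: sigma_pos_def sigma_neg_def)
  qed
  show ?thesis
    unfolding free_Z2_complex_def using asc inv simp free by blast
qed

lemma finite_chain_lengths:
  "finite {length Ss | Ss. set Ss \<subseteq> intersection_family A \<and> sorted_wrt (\<subset>) Ss}"
proof -
  have "length Ss \<le> card (intersection_family A)"
    if "set Ss \<subseteq> intersection_family A" "sorted_wrt (\<subset>) Ss" for Ss
  proof -
    have "distinct Ss" using that(2) by (induction Ss) auto
    then show ?thesis
      using that(1) by (metis card_mono distinct_card finite)
  qed
  then show ?thesis by (intro finite_subset[OF _ finite_atMost]) auto
qed

text \<open>Hence the subtraction in \<open>2 * height A - 1\<close> is not truncated unless all entries are
  \<open>Star\<close>. In that case the realization of \<open>sign_complex A\<close> is empty and its index, as a minimum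
  over \<open>d \<ge> 0\<close>, is \<open>0\<close>.\<close>

lemma height_pos:
  assumes "A $ i $ j \<noteq> Star"
  shows "1 \<le> height A"
proof -
  obtain S where S: "S \<in> row_sets A" "j \<in> S"
    using assms by (cases "A $ i $ j") (auto simp: row_sets_def row_pos_def row_neg_def)
  then have "S \<in> intersection_family A"
    unfolding intersection_family_def by (auto intro!: exI[of _ "{S}"])
  then have "length [S] \<in> {length Ss | Ss. set Ss \<subseteq> intersection_family A \<and> sorted_wrt (\<subset>) Ss}"
    by (intro CollectI exI[of _ "[S]"]) simp
  then show ?thesis
    unfolding height_def using Max_ge[OF finite_chain_lengths] by fastforce
qed

end

theory Submission
  imports Defs
begin

text \<open>
  A nonempty simplex \<open>s\<close> of the sign complex consists of the set \<open>P\<close> of indices that it contains with sign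
  \<open>+\<close> and the set \<open>Q\<close> of those with sign \<open>-\<close>; some row has \<open>P\<close> inside one of its two row sets and
  \<open>Q\<close> inside the other one. Closing \<open>P\<close> and \<open>Q\<close> under intersections of row sets gives two disjoint
  sets, each of which is empty or belongs to the intersection family (\<open>row_hull_sides_disjoint\<close>,
  \<open>row_hull_in_intersection_family\<close>). Both closures grow with \<open>s\<close>, and each one can grow at most
  \<open>height A\<close> times. So if every set is graded by the length of the longest chain of the family below
  it, the sum of the two grades takes values in \<open>{1..2 * height A}\<close>, and along a chain of simplices
  it stays constant only while both closures do. Flipping all signs swaps the two closures, which
  preserves the sum; as the closures are disjoint and not both empty, they differ, so the flip
  reverses their order in any enumeration of the sets.

  Grade and order together send the simplices, i.e. the vertices of the barycentric subdivision, to
  the vectors \<open>\<plusminus>e\<^sub>k\<close> with \<open>k < 2 * height A\<close>. This labelling is antipodal and never sends two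
  comparable simplices to opposite vectors, so its linear extension avoids the origin, and radial
  projection is an equivariant map to the sphere of dimension \<open>2 * height A - 1\<close>
  (\<open>Z2_index_le_of_graded_sign\<close>). The subdivision itself need not be constructed: it is enough to
  have continuous weights on the simplices such that the simplices of nonzero weight at a point form
  a chain (\<open>gap_weight\<close>).\<close>

section \<open>Maps to spheres from graded sign labellings\<close>

lemma Z2_index_le_of_nonvanishing:
  fixes g :: "('v::finite \<Rightarrow> real) \<Rightarrow> nat \<Rightarrow> real"
  assumes cont: "\<And>k. continuous_map (realization K) euclideanreal (\<lambda>x. g x k)"
    and equivariant: "\<And>x k. x \<in> topspace (realization K) \<Longrightarrow> g (x \<circ> \<nu>) k = - g x k"
    and nonzero: "\<And>x. x \<in> topspace (realization K) \<Longrightarrow> \<exists>k\<le>d. g x k \<noteq> 0"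
  shows "Z2_index K \<nu> \<le> enat d"
proof -
  define q where "q = (\<lambda>x. \<Sum>k\<le>d. (g x k)\<^sup>2)"
  define f where "f = (\<lambda>x k. if k \<le> d then g x k * inverse (sqrt (q x)) else 0)"
  have q_pos: "q x > 0" if "x \<in> topspace (realization K)" for x
    using nonzero[OF that] unfolding q_def by (auto intro!: sum_pos2)
  have "continuous_map (realization K) euclideanreal (\<lambda>x. g x k * inverse (sqrt (q x)))" for k
    unfolding q_def
    by (intro continuous_intros cont) (use q_pos in \<open>force simp: q_def\<close>)+
  then have coord: "continuous_map (realization K) euclideanreal (\<lambda>x. f x k)" for k
    by (cases "k \<le> d") (simp_all add: f_def)
  have unit: "(\<Sum>k\<le>d. (f x k)\<^sup>2) = 1" if "x \<in> topspace (realization K)" for x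
  proof -
    have "(\<Sum>k\<le>d. (f x k)\<^sup>2) = (\<Sum>k\<le>d. (g x k)\<^sup>2 * inverse (q x))"
      using q_pos[OF that] by (intro sum.cong) (auto simp: f_def power_mult_distrib power_inverse)
    also have "\<dots> = q x * inverse (q x)"
      by (simp add: q_def sum_distrib_right)
    finally show ?thesis
      using q_pos[OF that] by simp
  qed
  have "continuous_map (realization K) (nsphere d) f"
    unfolding nsphere continuous_map_in_subtopology continuous_map_componentwise_UNIV
    using coord unit by (auto simp: f_def)
  moreover have "f (x \<circ> \<nu>) = (\<lambda>k. - f x k)" if "x \<in> topspace (realization K)" for x
    using equivariant[OF that] by (auto simp: f_def q_def)
  ultimately show ?thesis
    unfolding Z2_index_def by (intro Inf_lower) blast
qed

text \<open>The nonempty sets \<open>s\<close> of nonzero weight are exactly the superlevel sets of \<open>x\<close>, which are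
  linearly ordered by inclusion. This makes the weights a substitute for the barycentric coordinates of
  \<open>x\<close> in the barycentric subdivision.\<close>

definition gap_weight :: "('v::finite \<Rightarrow> real) \<Rightarrow> 'v set \<Rightarrow> real"
  where "gap_weight x s = (\<Prod>v\<in>s. \<Prod>w\<in>-s. max 0 (x v - x w))"

lemma gap_weight_nonneg: "0 \<le> gap_weight x s"
  unfolding gap_weight_def by (intro prod_nonneg) auto

lemma gap_weight_eq_0_iff: "gap_weight x s = 0 \<longleftrightarrow> (\<exists>v\<in>s. \<exists>w\<in>-s. x v \<le> x w)"
proof -
  have "max 0 (x v - x w) = 0 \<longleftrightarrow> x v \<le> x w" for v w
    by linarith
  then show ?thesis
    by (auto simp: gap_weight_def)
qed

lemma gap_weight_chain:
  assumes "gap_weight x s \<noteq> 0" "gap_weight x t \<noteq> 0"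
  shows "s \<subseteq> t \<or> t \<subseteq> s"
proof (rule ccontr)
  assume "\<not> (s \<subseteq> t \<or> t \<subseteq> s)"
  then obtain v w where "v \<in> s - t" "w \<in> t - s"
    by blast
  then have "x w < x v" "x v < x w"
    using assms unfolding gap_weight_eq_0_iff by (meson Compl_iff DiffE not_le)+
  then show False
    by simp
qed

lemma gap_weight_comp:
  assumes "bij \<nu>"
  shows "gap_weight (x \<circ> \<nu>) s = gap_weight x (\<nu> ` s)"
proof -
  have inj: "inj_on \<nu> S" for S
    using assms by (meson bij_is_inj inj_on_subset subset_UNIV)
  show ?thesis
    unfolding gap_weight_def bij_image_Compl_eq[OF assms, symmetric]
    by (simp add: prod.reindex[OF inj])
qed

lemma continuous_map_gap_weight:
  "continuous_map (realization K) euclideanreal (\<lambda>x. gap_weight x s)"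
  unfolding gap_weight_def realization_def
  by (intro continuous_intros continuous_map_from_subtopology) auto

text \<open>The labelling \<open>s \<mapsto> \<epsilon> s \<cdot> e\<^sub>k\<close> with \<open>k = \<rho> s\<close>, extended linearly over the
  chains of simplices, is equivariant. In a fixed coordinate, comparable simplices contribute with the
  same sign, so nothing cancels and the origin is avoided.\<close>

proposition Z2_index_le_of_graded_sign:
  fixes K :: "('v::finite) set set" and \<rho> :: "'v set \<Rightarrow> nat" and \<epsilon> :: "'v set \<Rightarrow> real"
  assumes free: "free_Z2_complex K \<nu>"
    and le: "\<And>s. s \<in> K \<Longrightarrow> s \<noteq> {} \<Longrightarrow> \<rho> s \<le> d"
    and rank_flip: "\<And>s. s \<in> K \<Longrightarrow> s \<noteq> {} \<Longrightarrow> \<rho> (\<nu> ` s) = \<rho> s"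
    and sign_flip: "\<And>s. s \<in> K \<Longrightarrow> s \<noteq> {} \<Longrightarrow> \<epsilon> (\<nu> ` s) = - \<epsilon> s"
    and sign_nonzero: "\<And>s. s \<in> K \<Longrightarrow> s \<noteq> {} \<Longrightarrow> \<epsilon> s \<noteq> 0"
    and sign_eq: "\<And>s t. s \<in> K \<Longrightarrow> t \<in> K \<Longrightarrow> s \<noteq> {} \<Longrightarrow> s \<subseteq> t \<Longrightarrow> \<rho> s = \<rho> t \<Longrightarrow> \<epsilon> s = \<epsilon> t"
  shows "Z2_index K \<nu> \<le> enat d"
proof -
  define L where "L = (\<lambda>k. {s \<in> K. s \<noteq> {} \<and> \<rho> s = k})"
  define g where "g = (\<lambda>x k. \<Sum>s\<in>L k. \<epsilon> s * gap_weight x s)"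
  have invol: "\<nu> (\<nu> v) = v" for v
    using free by (simp add: free_Z2_complex_def)
  have inv_simplex: "\<nu> ` s \<in> K" if "s \<in> K" for s
    using free that by (simp add: free_Z2_complex_def)
  have bij: "bij \<nu>"
    using invol by (metis involuntory_imp_bij)
  have image_invol: "\<nu> ` \<nu> ` s = s" for s
    by (simp add: image_image invol)
  have L_flip: "\<nu> ` s \<in> L k" if "s \<in> L k" for s k
    using that inv_simplex rank_flip by (auto simp: L_def)
  have "continuous_map (realization K) euclideanreal (\<lambda>x. g x k)" for k
    unfolding g_def by (intro continuous_intros continuous_map_gap_weight) auto
  moreover have "g (x \<circ> \<nu>) k = - g x k" for x k
  proof -
    have "g (x \<circ> \<nu>) k = (\<Sum>s\<in>L k. \<epsilon> s * gap_weight x (\<nu> ` s))"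
      by (simp add: g_def gap_weight_comp[OF bij])
    also have "\<dots> = (\<Sum>s\<in>L k. \<epsilon> (\<nu> ` s) * gap_weight x s)"
      by (rule sum.reindex_bij_witness[of _ "image \<nu>" "image \<nu>"]) (auto simp: image_invol L_flip)
    also have "\<dots> = (\<Sum>s\<in>L k. - (\<epsilon> s * gap_weight x s))"
      by (intro sum.cong) (auto simp: L_def sign_flip)
    finally show ?thesis
      by (simp add: g_def sum_negf)
  qed
  moreover have "\<exists>k\<le>d. g x k \<noteq> 0" if x: "x \<in> topspace (realization K)" for x
  proof -
    define s where "s = {v. x v \<noteq> 0}"
    have nonneg: "\<And>v. 0 \<le> x v" and sum1: "(\<Sum>v\<in>UNIV. x v) = 1" and sK: "s \<in> K"
      using x by (auto simp: realization_def s_def)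
    have s_ne: "s \<noteq> {}"
    proof
      assume "s = {}"
      then have "\<And>v. x v = 0"
        by (auto simp: s_def)
      then show False
        using sum1 by simp
    qed
    have weight_s: "gap_weight x s \<noteq> 0"
      using nonneg by (fastforce simp: gap_weight_eq_0_iff s_def order.antisym)
    have sL: "s \<in> L (\<rho> s)"
      using sK s_ne by (simp add: L_def)
    have same_sign: "\<epsilon> t * gap_weight x t = \<epsilon> s * gap_weight x t" if t: "t \<in> L (\<rho> s)" for t
    proof (cases "gap_weight x t = 0")
      case False
      then have "t \<subseteq> s \<or> s \<subseteq> t"
        using gap_weight_chain weight_s by blast
      then have "\<epsilon> t = \<epsilon> s"
        using t sL sign_eq[of s t] sign_eq[of t s] by (auto simp: L_def)
      then show ?thesis
        by simp
    qed simp
    have "g x (\<rho> s) = \<epsilon> s * (\<Sum>t\<in>L (\<rho> s). gap_weight x t)"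
      unfolding g_def sum_distrib_left using same_sign by (intro sum.cong) auto
    moreover have "(\<Sum>t\<in>L (\<rho> s). gap_weight x t) > 0"
      using sL weight_s gap_weight_nonneg
      by (intro sum_pos2[of _ s]) (auto simp: order_less_le)
    ultimately show ?thesis
      using le[OF sK s_ne] sign_nonzero[OF sK s_ne] by auto
  qed
  ultimately show ?thesis
    by (rule Z2_index_le_of_nonvanishing)
qed

section \<open>Closure and depth of index sets\<close>

text \<open>The empty set is kept fixed, rather than mapped to the intersection of all row sets, because
  the empty side of a simplex has to sit below all members of the intersection family.\<close>

definition row_hull :: "psign^'n^'m \<Rightarrow> 'n set \<Rightarrow> 'n set"
  where "row_hull A P = (if P = {} then {} else \<Inter>{R \<in> row_sets A. P \<subseteq> R})"

lemma subset_row_hull: "P \<subseteq> row_hull A P"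
  by (auto simp: row_hull_def)

lemma row_hull_mono: "P \<subseteq> Q \<Longrightarrow> row_hull A P \<subseteq> row_hull A Q"
  by (auto simp: row_hull_def)

lemma row_hull_subset: "R \<in> row_sets A \<Longrightarrow> P \<subseteq> R \<Longrightarrow> row_hull A P \<subseteq> R"
  by (auto simp: row_hull_def)

lemma row_hull_in_intersection_family:
  assumes "R \<in> row_sets A" "P \<subseteq> R" "P \<noteq> {}"
  shows "row_hull A P \<in> intersection_family A"
proof -
  have "row_hull A P \<noteq> {}"
    using subset_row_hull assms(3) by blast
  then show ?thesis
    using assms unfolding intersection_family_def
    by (auto simp: row_hull_def intro!: exI[of _ "{R \<in> row_sets A. P \<subseteq> R}"])
qed

definition depth :: "psign^'n^'m \<Rightarrow> 'n set \<Rightarrow> nat"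
  where "depth A U =
    Max {length Ss | Ss. set Ss \<subseteq> intersection_family A \<inter> Pow U \<and> sorted_wrt (\<subset>) Ss}"

lemma finite_depth_lengths:
  "finite {length Ss | Ss. set Ss \<subseteq> intersection_family A \<inter> Pow U \<and> sorted_wrt (\<subset>) Ss}"
  by (rule finite_subset[OF _ finite_chain_lengths[of A]]) auto

lemma depth_attained:
  obtains Ss where "set Ss \<subseteq> intersection_family A \<inter> Pow U" "sorted_wrt (\<subset>) Ss"
    "length Ss = depth A U"
proof -
  have "length [] \<in> {length Ss | Ss. set Ss \<subseteq> intersection_family A \<inter> Pow U \<and> sorted_wrt (\<subset>) Ss}"
    by (intro CollectI exI[of _ "[]"]) simp
  then have "depth A U \<in>
      {length Ss | Ss. set Ss \<subseteq> intersection_family A \<inter> Pow U \<and> sorted_wrt (\<subset>) Ss}"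
    unfolding depth_def by (intro Max_in finite_depth_lengths) blast
  then show thesis
    using that by auto
qed

lemma length_le_depth:
  assumes "set Ss \<subseteq> intersection_family A \<inter> Pow U" "sorted_wrt (\<subset>) Ss"
  shows "length Ss \<le> depth A U"
  unfolding depth_def using assms by (intro Max_ge finite_depth_lengths) blast

lemma depth_le_height: "depth A U \<le> height A"
proof -
  obtain Ss where "set Ss \<subseteq> intersection_family A \<inter> Pow U" "sorted_wrt (\<subset>) Ss"
    "length Ss = depth A U"
    by (rule depth_attained)
  then show ?thesis
    unfolding height_def by (intro Max_ge finite_chain_lengths CollectI exI[of _ Ss]) auto
qed

lemma depth_strict_mono:
  assumes "U \<subset> V" "V \<in> intersection_family A"
  shows "depth A U < depth A V"
proof -
  obtain Ss where Ss: "set Ss \<subseteq> intersection_family A \<inter> Pow U" "sorted_wrt (\<subset>) Ss"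
    "length Ss = depth A U"
    by (rule depth_attained)
  have "set (Ss @ [V]) \<subseteq> intersection_family A \<inter> Pow V"
    using Ss(1) assms by auto
  moreover have "sorted_wrt (\<subset>) (Ss @ [V])"
    using Ss(1,2) assms(1) by (auto simp: sorted_wrt_append)
  ultimately have "length (Ss @ [V]) \<le> depth A V"
    by (rule length_le_depth)
  then show ?thesis
    using Ss(3) by simp
qed

section \<open>The two sides of a simplex of the sign complex\<close>

definition side :: "('n \<times> bool) set \<Rightarrow> bool \<Rightarrow> 'n set"
  where "side s b = {i. (i, b) \<in> s}"

lemma side_mono: "s \<subseteq> t \<Longrightarrow> side s b \<subseteq> side t b"
  by (auto simp: side_def)

lemma side_flip: "side (flip_sign ` s) b = side s (\<not> b)"
  by (force simp: side_def flip_sign_def)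

lemma side_nonempty:
  assumes "s \<noteq> {}"
  obtains b where "side s b \<noteq> {}"
  using assms by (auto simp: side_def)

lemma sides_in_opposite_row_sets:
  assumes "s \<in> sign_complex A"
  obtains R where "\<And>b. R b \<in> row_sets A" "\<And>b. side s b \<subseteq> R b" "R True \<inter> R False = {}"
proof -
  obtain r where "s \<subseteq> sigma_pos A r \<or> s \<subseteq> sigma_neg A r"
    using assms by (auto simp: sign_complex_def)
  then obtain c where c: "\<And>b. side s b \<subseteq> (if b = c then row_pos A r else row_neg A r)"
  proof
    assume "s \<subseteq> sigma_pos A r"
    then show thesis
      by (intro that[of True])
        (auto simp: side_def sigma_pos_def row_pos_def row_neg_def)
  next
    assume "s \<subseteq> sigma_neg A r"
    then show thesis
      by (intro that[of False])
        (auto simp: side_def sigma_neg_def row_pos_def row_neg_def)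
  qed
  show thesis
    by (rule that[of "\<lambda>b. if b = c then row_pos A r else row_neg A r"])
      (use c in \<open>auto simp: row_sets_def row_pos_def row_neg_def\<close>)
qed

lemma row_hull_sides_disjoint:
  assumes "s \<in> sign_complex A"
  shows "row_hull A (side s True) \<inter> row_hull A (side s False) = {}"
proof -
  obtain R where "\<And>b. R b \<in> row_sets A" "\<And>b. side s b \<subseteq> R b" "R True \<inter> R False = {}"
    using sides_in_opposite_row_sets[OF assms] by metis
  then show ?thesis
    using row_hull_subset by blast
qed

lemma row_hull_sides_distinct:
  assumes "s \<in> sign_complex A" "s \<noteq> {}"
  shows "row_hull A (side s True) \<noteq> row_hull A (side s False)"
proof -
  obtain b where "side s b \<noteq> {}"
    using side_nonempty[OF assms(2)] .
  then have "row_hull A (side s b) \<noteq> {}"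
    using subset_row_hull by blast
  then show ?thesis
    using row_hull_sides_disjoint[OF assms(1)] by (cases b) auto
qed

lemma row_hull_side_in_intersection_family:
  assumes "s \<in> sign_complex A" "side s b \<noteq> {}"
  shows "row_hull A (side s b) \<in> intersection_family A"
  using sides_in_opposite_row_sets[OF assms(1)] row_hull_in_intersection_family assms(2) by metis

lemma depth_row_hull_side_strict_mono:
  assumes "t \<in> sign_complex A" "s \<subseteq> t" "row_hull A (side s b) \<noteq> row_hull A (side t b)"
  shows "depth A (row_hull A (side s b)) < depth A (row_hull A (side t b))"
proof (rule depth_strict_mono)
  show "row_hull A (side s b) \<subset> row_hull A (side t b)"
    using row_hull_mono[OF side_mono[OF assms(2)]] assms(3) by blast
  then have "side t b \<noteq> {}"
    by (auto simp: row_hull_def)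
  then show "row_hull A (side t b) \<in> intersection_family A"
    using row_hull_side_in_intersection_family[OF assms(1)] by blast
qed

definition total_depth :: "psign^'n^'m \<Rightarrow> ('n \<times> bool) set \<Rightarrow> nat"
  where "total_depth A s = depth A (row_hull A (side s True)) + depth A (row_hull A (side s False))"

lemma total_depth_pos:
  assumes "s \<in> sign_complex A" "s \<noteq> {}"
  shows "0 < total_depth A s"
proof -
  obtain b where b: "side s b \<noteq> {}"
    using side_nonempty[OF assms(2)] .
  then have "{} \<subset> row_hull A (side s b)"
    using subset_row_hull by blast
  then have "depth A {} < depth A (row_hull A (side s b))"
    using row_hull_side_in_intersection_family[OF assms(1) b] by (rule depth_strict_mono)
  then show ?thesis
    by (cases b) (auto simp: total_depth_def)
qed

lemma total_depth_le: "total_depth A s \<le> 2 * height A"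
  using depth_le_height[of A "row_hull A (side s True)"]
    depth_le_height[of A "row_hull A (side s False)"]
  by (simp add: total_depth_def)

lemma row_hull_sides_eq_if_total_depth_eq:
  assumes "t \<in> sign_complex A" "s \<subseteq> t" "total_depth A s = total_depth A t"
  shows "row_hull A (side s b) = row_hull A (side t b)"
proof -
  have "depth A (row_hull A (side s c)) \<le> depth A (row_hull A (side t c))" for c
    using depth_row_hull_side_strict_mono[OF assms(1,2), of c]
    by (cases "row_hull A (side s c) = row_hull A (side t c)") auto
  from this[of True] this[of False]
  have "depth A (row_hull A (side s b)) = depth A (row_hull A (side t b))"
    using assms(3) by (cases b) (auto simp: total_depth_def)
  then show ?thesis
    using depth_row_hull_side_strict_mono[OF assms(1,2), of b] by fastforce
qed

section \<open>The index bound\<close>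

theorem theorem27:
  fixes A :: "psign^'n^'m"
  shows "Z2_index (sign_complex A) flip_sign \<le> enat (2 * height A - 1)"
proof -
  obtain num :: "'n set \<Rightarrow> nat" where num: "inj num"
    using finite_imp_inj_to_nat_seg[of "UNIV :: 'n set set"] by auto
  define \<epsilon> where "\<epsilon> = (\<lambda>s.
    real (num (row_hull A (side s True))) - real (num (row_hull A (side s False))))"
  \<comment> \<open>Total depths of nonempty simplices start at \<open>1\<close>, but the coordinates of the sphere at \<open>0\<close>.\<close>
  show ?thesis
  proof (rule Z2_index_le_of_graded_sign[where \<rho> = "\<lambda>s. total_depth A s - 1" and \<epsilon> = \<epsilon>])
    show "free_Z2_complex (sign_complex A) flip_sign"
      by (rule free_Z2_complex_sign_complex)
  next
    fix s assume "s \<in> sign_complex A" "s \<noteq> {}"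
    show "total_depth A s - 1 \<le> 2 * height A - 1"
      using total_depth_le by (rule diff_le_mono)
    show "total_depth A (flip_sign ` s) - 1 = total_depth A s - 1"
      by (simp add: total_depth_def side_flip)
    show "\<epsilon> (flip_sign ` s) = - \<epsilon> s"
      by (simp add: \<epsilon>_def side_flip)
    show "\<epsilon> s \<noteq> 0"
      using row_hull_sides_distinct[OF \<open>s \<in> sign_complex A\<close> \<open>s \<noteq> {}\<close>] num
      by (auto simp: \<epsilon>_def inj_eq)
  next
    fix s t
    assume "s \<in> sign_complex A" "t \<in> sign_complex A" "s \<noteq> {}" "s \<subseteq> t"
      and eq: "total_depth A s - 1 = total_depth A t - 1"
    then have "0 < total_depth A s" "0 < total_depth A t"
      by (auto intro!: total_depth_pos)
    then have "total_depth A s = total_depth A t"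
      using eq by linarith
    then show "\<epsilon> s = \<epsilon> t"
      using row_hull_sides_eq_if_total_depth_eq[OF \<open>t \<in> sign_complex A\<close> \<open>s \<subseteq> t\<close>]
      by (simp add: \<epsilon>_def)
  qed
qed

end
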